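(* Let $L(t,q,\dot q)$ be a Lagrangian function ($t\in\mathbb{R}$, $q,\dot q\in\mathbb{R}^n$) of class $C^3$ whose Hessian matrix $g:=\partial^2_{\dot q,\dot q}L(t,q,\dot q)$ satisfies $\det g\neq 0$ everywhere. Suppose that the Lagrange equation of $L$ has the $C^2$ first integral $N(t,q,\dot q)$. Let $(\tau,\xi,f)$ be a triple of $C^1$ functions of $(t,q,\dot q)$, with $\tau,f$ real-valued and $\xi$ valued in $\mathbb{R}^n$. Then $(\tau,\xi,f)$ is a solution of the strong version of the Killing-type equation with $N$ as associated first integral if and only if, identically in $(t,q,\dot q)$, $$\xi=\tau\dot q-g^{-1}\partial_{\dot q}N,\qquad f=\tau L+N-\partial_{\dot q}L\cdot g^{-1}\partial_{\dot q}N .$$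
   Context: All functions are functions of the independent variables $t\in\mathbb{R}$, $q,\dot q\in\mathbb{R}^n$. $\partial_t,\partial_q,\partial_{\dot q}$ denote partial derivative and gradients, $\cdot$ is the standard scalar product of $\mathbb{R}^n$, and $\partial^2_{\dot q,\dot q}L$ is the Hessian matrix of $L$ with respect to $\dot q$. The Lagrange equation is $\frac{d}{dt}\partial_{\dot q}L(t,q(t),\dot q(t))-\partial_qL(t,q(t),\dot q(t))=0$; since $\det g\ne0$ it can be put in normal form $\ddot q=\Lambda(t,q,\dot q)$, with $\Lambda=g^{-1}(\partial_qL-\partial^2_{\dot q,t}L-\partial^2_{\dot q,q}L\,\dot q)$. A function $N(t,q,\dot q)$ is a first integral if it is constant along all solutions of the Lagrange equation, i.e. $\partial_tN+\partial_qN\cdot\dot q+\partial_{\dot q}N\cdot\Lambda=0$ identically. The Killing-type equation for a triple $(\tau,\xi,f)$ is $$\tau\,\partial_tL+\partial_qL\cdot\xi+\partial_{\dot q}L\cdot(\dot\xi-\dot q\,\dot\tau)+L\,\dot\tau=\dot f .$$ Strong version: the total time derivative of $x\in\{\tau,\xi,f\}$ is interpreted as $\dot x=\partial_tx+(\partial_qx)\dot q+(\partial_{\dot q}x)\ddot q$, where $\ddot q\in\mathbb{R}^n$ is treated as a further independent variable, and the equation is required to hold for all $t,q,\dot q,\ddot q$. The first integral associated to a solution triple $(\tau,\xi,f)$ is the function $f-L\tau-\partial_{\dot q}L\cdot(\xi-\dot q\,\tau)$; "with $N$ as associated first integral" means that this function equals $N$. *)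

theory Defs
  imports "HOL-Analysis.Analysis"
begin

(* Class C^k on the whole space. In the step case, requiring this of all directional derivatives
   of a (Frechet) differentiable function amounts to requiring it of all partial derivatives. *)
primrec class_C :: "nat \<Rightarrow> ('a::euclidean_space \<Rightarrow> 'b::real_normed_vector) \<Rightarrow> bool" where
  "class_C 0 F \<longleftrightarrow> continuous_on UNIV F"
| "class_C (Suc k) F \<longleftrightarrow>
     (\<forall>x. F differentiable (at x)) \<and> (\<forall>h. class_C k (\<lambda>x. frechet_derivative F (at x) h))"

definition gradient :: "('a::real_inner \<Rightarrow> real) \<Rightarrow> 'a \<Rightarrow> 'a" where
  "gradient \<phi> x = (THE D. GDERIV \<phi> x :> D)"

(* Functions of (t, q, dq/dt) are curried; the third argument is called v throughout. *)
type_synonym ('n, 'b) phase_fun = "real \<Rightarrow> real ^ 'n \<Rightarrow> real ^ 'n \<Rightarrow> 'b"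

definition partial_t :: "('n::finite, 'b::real_normed_vector) phase_fun \<Rightarrow> ('n, 'b) phase_fun" where
  "partial_t F t q v = vector_derivative (\<lambda>s. F s q v) (at t)"

definition grad_q :: "('n::finite, real) phase_fun \<Rightarrow> ('n, real ^ 'n) phase_fun" where
  "grad_q F t q v = gradient (\<lambda>x. F t x v) q"

definition grad_v :: "('n::finite, real) phase_fun \<Rightarrow> ('n, real ^ 'n) phase_fun" where
  "grad_v F t q v = gradient (\<lambda>w. F t q w) v"

definition hessian_v :: "('n::finite, real) phase_fun \<Rightarrow> ('n, real ^ 'n ^ 'n) phase_fun" where
  "hessian_v L t q v = jacobian (\<lambda>w. grad_v L t q w) (at v)"

(* The curve q with velocity u is a twice differentiable solution on I of
   d/dt (grad_v L) - grad_q L = 0. *)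
definition lagrange_solution ::
  "('n::finite, real) phase_fun \<Rightarrow> real set \<Rightarrow> (real \<Rightarrow> real ^ 'n) \<Rightarrow> (real \<Rightarrow> real ^ 'n) \<Rightarrow> bool" where
  "lagrange_solution L I q u \<longleftrightarrow>
     (\<forall>t\<in>I. (q has_vector_derivative u t) (at t) \<and>
            u differentiable (at t) \<and>
            ((\<lambda>s. grad_v L s (q s) (u s)) has_vector_derivative grad_q L t (q t) (u t)) (at t))"

(* The intervals I are arbitrary, since solutions need not be defined for all times. *)
definition first_integral ::
  "('n::finite, real) phase_fun \<Rightarrow> ('n, real) phase_fun \<Rightarrow> bool" where
  "first_integral L N \<longleftrightarrow>
     (\<forall>I q u. open I \<and> is_interval I \<and> lagrange_solution L I q u \<longrightarrow>
        (\<lambda>t. N t (q t) (u t)) constant_on I)"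

(* The formal total time derivative; the acceleration a is an independent variable. *)
definition total_deriv ::
  "('n::finite, 'b::real_normed_vector) phase_fun \<Rightarrow> real \<Rightarrow> real ^ 'n \<Rightarrow> real ^ 'n \<Rightarrow> real ^ 'n \<Rightarrow> 'b" where
  "total_deriv F t q v a =
     partial_t F t q v + frechet_derivative (\<lambda>x. F t x v) (at q) v
       + frechet_derivative (\<lambda>w. F t q w) (at v) a"

definition strong_killing ::
  "('n::finite, real) phase_fun \<Rightarrow> ('n, real) phase_fun \<Rightarrow> ('n, real ^ 'n) phase_fun
     \<Rightarrow> ('n, real) phase_fun \<Rightarrow> bool" where
  "strong_killing L \<tau> \<xi> f \<longleftrightarrow>
     (\<forall>t q v a.
        \<tau> t q v * partial_t L t q v
        + grad_q L t q v \<bullet> \<xi> t q v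
        + grad_v L t q v \<bullet> (total_deriv \<xi> t q v a - total_deriv \<tau> t q v a *\<^sub>R v)
        + L t q v * total_deriv \<tau> t q v a
        = total_deriv f t q v a)"

definition associated_integral ::
  "('n::finite, real) phase_fun \<Rightarrow> ('n, real) phase_fun \<Rightarrow> ('n, real ^ 'n) phase_fun
     \<Rightarrow> ('n, real) phase_fun \<Rightarrow> ('n, real) phase_fun" where
  "associated_integral L \<tau> \<xi> f t q v =
     f t q v - L t q v * \<tau> t q v - grad_v L t q v \<bullet> (\<xi> t q v - \<tau> t q v *\<^sub>R v)"

end

theory Submission
  imports Defs
begin

text \<open>
  Let \<open>P = grad_v L\<close>, let \<open>g\<close> be the Hessian of \<open>L\<close> in \<open>v\<close>, let \<open>\<Lambda>\<close> be the acceleration in the normal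
  form of the Lagrange equation, and let a prime denote the formal total time derivative in which
  the acceleration \<open>a\<close> is free. Differentiating the associated integral \<open>I = f - L \<tau> - P \<bullet> (\<xi> - \<tau> v)\<close> by
  the product rule gives, for all functions involved, the identity
  \<open>Killing left side - f' = (grad_q L - P') \<bullet> (\<xi> - \<tau> v) - I'\<close> (lemma \<open>killing_defect\<close>).

  Two facts turn this into the theorem. By definition of \<open>\<Lambda>\<close>, \<open>P' - grad_q L = g (a - \<Lambda>)\<close>; and
  since \<open>N\<close> is a first integral, its derivative in the direction \<open>(1, v, \<Lambda>)\<close> vanishes, so that
  \<open>N' = grad_v N \<bullet> (a - \<Lambda>)\<close>. As \<open>g\<close> is symmetric, \<open>I = N\<close> implies that the two sides of the Killing
  equation differ by \<open>- (grad_v N + g (\<xi> - \<tau> v)) \<bullet> (a - \<Lambda>)\<close>. This vanishes for every \<open>a\<close> exactly when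
  \<open>g (\<xi> - \<tau> v) = - grad_v N\<close>, which is the formula for \<open>\<xi>\<close>; given this formula, \<open>I = N\<close> is the
  formula for \<open>f\<close>.

  The analytic content lies in the pointwise form of the first integral property. A first integral is
  constant along solutions, so a solution must exist through every point
  \<open>(t, q, v)\<close>. The field \<open>(1, v, \<Lambda>)\<close> is locally Lipschitz because it solves a linear system with locally
  Lipschitz coefficients (\<open>lipschitz_linear_solution\<close>), and the Picard-Lindeloef theorem applies
  (\<open>picard_lindeloef\<close>). The symmetry of \<open>g\<close> is the symmetry of second derivatives
  (\<open>second_derivative_symmetric\<close>).
\<close>

section \<open>Calculus of functions of class C^k\<close>

abbreviation Df :: "('a::real_normed_vector \<Rightarrow> 'b::real_normed_vector) \<Rightarrow> 'a \<Rightarrow> 'a \<Rightarrow> 'b" where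
  "Df F x \<equiv> frechet_derivative F (at x)"

lemma Df_eqI: "(F has_derivative F') (at x) \<Longrightarrow> Df F x = F'"
  by (rule frechet_derivative_at [symmetric])

lemma class_C_differentiable: "class_C (Suc k) F \<Longrightarrow> F differentiable (at x)"
  by simp

lemma class_C_has_derivative: "class_C (Suc k) F \<Longrightarrow> (F has_derivative Df F x) (at x)"
  by (simp add: frechet_derivative_works [symmetric])

lemma class_C_continuous: "class_C k F \<Longrightarrow> continuous_on S F"
  by (cases k)
    (auto intro: continuous_on_subset simp: continuous_at_imp_continuous_on differentiable_imp_continuous_within)

lemma class_C_zero: "class_C k (\<lambda>x. 0)"
  by (induction k) simp_all

lemma class_C_add:
  "class_C k F \<Longrightarrow> class_C k G \<Longrightarrow> class_C k (\<lambda>x. F x + G x)"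
proof (induction k arbitrary: F G)
  case 0
  then show ?case by (simp add: continuous_on_add)
next
  case (Suc k)
  have "Df (\<lambda>x. F x + G x) x = (\<lambda>h. Df F x h + Df G x h)" for x
    by (intro Df_eqI has_derivative_add class_C_has_derivative [OF Suc.prems(1)]
        class_C_has_derivative [OF Suc.prems(2)])
  with Suc show ?case by simp
qed

lemma class_C_bounded_linear:
  assumes "bounded_linear T"
  shows "class_C k F \<Longrightarrow> class_C k (\<lambda>x. T (F x))"
proof (induction k arbitrary: F)
  case 0
  then show ?case
    by (simp add: bounded_linear.continuous_on [OF assms])
next
  case (Suc k)
  have der: "((\<lambda>x. T (F x)) has_derivative (\<lambda>h. T (Df F x h))) (at x)" for x
    by (rule bounded_linear.has_derivative [OF assms class_C_has_derivative [OF Suc.prems]])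
  have "Df (\<lambda>x. T (F x)) x = (\<lambda>h. T (Df F x h))" for x
    by (rule Df_eqI [OF der])
  with Suc der show ?case by (auto simp: differentiable_def)
qed

lemma class_C_sum:
  "finite I \<Longrightarrow> (\<And>i. i \<in> I \<Longrightarrow> class_C k (F i)) \<Longrightarrow> class_C k (\<lambda>x. \<Sum>i\<in>I. F i x)"
  by (induction I rule: finite_induct) (simp_all add: class_C_zero class_C_add)

lemma class_C_componentwise:
  fixes F :: "'a::euclidean_space \<Rightarrow> 'b::euclidean_space"
  assumes "\<And>b. b \<in> Basis \<Longrightarrow> class_C k (\<lambda>x. F x \<bullet> b)"
  shows "class_C k F"
proof -
  have "class_C k (\<lambda>x. \<Sum>b\<in>Basis. (F x \<bullet> b) *\<^sub>R b)"
    by (intro class_C_sum class_C_bounded_linear [OF bounded_linear_scaleR_left] assms) simp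
  then show ?thesis by (simp add: euclidean_representation)
qed

lemma linear_norm_le_sum_Basis:
  fixes T :: "'a::euclidean_space \<Rightarrow> 'b::real_normed_vector"
  assumes "linear T"
  shows "norm (T h) \<le> (\<Sum>b\<in>Basis. norm (T b)) * norm h"
proof -
  have "T h = T (\<Sum>b\<in>Basis. (h \<bullet> b) *\<^sub>R b)"
    by (simp add: euclidean_representation)
  also have "\<dots> = (\<Sum>b\<in>Basis. (h \<bullet> b) *\<^sub>R T b)"
    using assms by (simp add: linear_sum linear_cmul)
  also have "norm \<dots> \<le> (\<Sum>b\<in>Basis. norm (T b) * norm h)"
    by (intro sum_norm_le)
      (metis Basis_le_norm mult.commute mult_left_mono norm_ge_zero norm_scaleR real_norm_def)
  finally show ?thesis by (simp add: sum_distrib_right)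
qed

text \<open>On a compact ball the finitely many derivatives along basis vectors are bounded, and they
  bound the operator norm of the whole derivative.\<close>

lemma class_C_lipschitz_on_cball:
  fixes F :: "'a::euclidean_space \<Rightarrow> 'b::real_normed_vector"
  assumes "class_C (Suc k) F"
  shows "\<exists>K. K-lipschitz_on (cball x r) F"
proof -
  define g where "g y = (\<Sum>b\<in>Basis. norm (Df F y b))" for y
  have "continuous_on (cball x r) g"
    unfolding g_def using assms
    by (intro continuous_on_sum continuous_on_norm class_C_continuous [of k]) simp
  then have "bounded (g ` cball x r)"
    by (intro compact_imp_bounded compact_continuous_image) auto
  then obtain K where K: "K > 0" "\<And>y. y \<in> cball x r \<Longrightarrow> norm (g y) \<le> K"
    by (auto simp: bounded_pos)
  have "K-lipschitz_on (cball x r) F"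
  proof (rule bounded_derivative_imp_lipschitz)
    fix y assume y: "y \<in> cball x r"
    show "(F has_derivative Df F y) (at y within cball x r)"
      by (rule has_derivative_at_withinI [OF class_C_has_derivative [OF assms]])
    have "linear (Df F y)"
      by (rule has_derivative_linear [OF class_C_has_derivative [OF assms]])
    then have "norm (Df F y h) \<le> K * norm h" for h
      using linear_norm_le_sum_Basis [of "Df F y" h] K(2) [OF y]
      by (fold g_def) (smt (verit) mult_right_mono norm_ge_zero real_norm_def)
    then show "onorm (Df F y) \<le> K"
      by (rule onorm_le)
  qed (use K in auto)
  then show ?thesis by blast
qed

text \<open>The preceding Lipschitz bound, applied to the derivative along each basis vector. It is
  stated with an explicit factor \<open>norm h\<close>, which says that the derivative is Lipschitz as an
  operator-valued map.\<close>

lemma class_C_Df_lipschitz_on_cball: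
  fixes F :: "'a::euclidean_space \<Rightarrow> 'b::real_normed_vector"
  assumes "class_C (Suc (Suc k)) F"
  shows "\<exists>K. \<forall>y\<in>cball x r. \<forall>z\<in>cball x r. \<forall>h. norm (Df F y h - Df F z h) \<le> K * dist y z * norm h"
proof -
  have "\<exists>K. K-lipschitz_on (cball x r) (\<lambda>y. Df F y b)" for b
    using assms by (intro class_C_lipschitz_on_cball [of k]) simp
  then obtain K where K: "\<And>b. (K b)-lipschitz_on (cball x r) (\<lambda>y. Df F y b)"
    by metis
  have "norm (Df F y h - Df F z h) \<le> (\<Sum>b\<in>Basis. K b) * dist y z * norm h"
    if "y \<in> cball x r" "z \<in> cball x r" for y z h
  proof -
    have "linear (\<lambda>h. Df F y h - Df F z h)"
      by (intro linear_compose_sub has_derivative_linear [OF class_C_has_derivative [OF assms]])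
    then have "norm (Df F y h - Df F z h) \<le> (\<Sum>b\<in>Basis. norm (Df F y b - Df F z b)) * norm h"
      by (rule linear_norm_le_sum_Basis)
    also have "\<dots> \<le> (\<Sum>b\<in>Basis. K b * dist y z) * norm h"
      by (intro mult_right_mono sum_mono)
        (use that lipschitz_onD [OF K] in \<open>auto simp: dist_norm\<close>)
    finally show ?thesis by (simp add: sum_distrib_right)
  qed
  then show ?thesis by blast
qed

lemma class_C_has_real_derivative_line:
  fixes F :: "'a::euclidean_space \<Rightarrow> real"
  assumes "class_C (Suc k) F"
  shows "((\<lambda>s. F (p + s *\<^sub>R h)) has_real_derivative Df F (p + s *\<^sub>R h) h) (at s)"
proof -
  have "((\<lambda>s. F (p + s *\<^sub>R h)) has_derivative (\<lambda>ds. Df F (p + s *\<^sub>R h) (ds *\<^sub>R h))) (at s)"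
    by (rule has_derivative_compose [OF _ class_C_has_derivative [OF assms]])
      (auto intro!: derivative_eq_intros)
  moreover have "linear (Df F (p + s *\<^sub>R h))"
    by (rule has_derivative_linear [OF class_C_has_derivative [OF assms]])
  ultimately show ?thesis
    by (simp add: has_field_derivative_def linear_cmul mult_commute_abs)
qed

text \<open>The mean value theorem is used twice: on the difference of \<open>F\<close> along two parallel edges in the direction
  \<open>h\<close>, then on the derivative in the direction \<open>h\<close> along an edge in the direction \<open>k'\<close>. The left-hand
  side is symmetric in \<open>h\<close> and \<open>k'\<close>, and this forces the mixed derivatives to agree.\<close>

lemma second_difference_mean_value:
  fixes F :: "'a::euclidean_space \<Rightarrow> real"
  assumes "class_C (Suc (Suc k)) F" and s: "s > 0"
  obtains \<theta> \<theta>' where "0 < \<theta>" "\<theta> < s" "0 < \<theta>'" "\<theta>' < s"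
    and "F (x + s *\<^sub>R h + s *\<^sub>R k') - F (x + s *\<^sub>R h) - F (x + s *\<^sub>R k') + F x
         = s\<^sup>2 * Df (\<lambda>y. Df F y h) (x + \<theta> *\<^sub>R h + \<theta>' *\<^sub>R k') k'"
proof -
  define u where "u \<sigma> = F (x + s *\<^sub>R k' + \<sigma> *\<^sub>R h) - F (x + \<sigma> *\<^sub>R h)" for \<sigma>
  have "(u has_real_derivative Df F (x + s *\<^sub>R k' + \<sigma> *\<^sub>R h) h - Df F (x + \<sigma> *\<^sub>R h) h) (at \<sigma>)" for \<sigma>
    unfolding u_def by (intro DERIV_diff class_C_has_real_derivative_line [OF assms(1)])
  from MVT2 [OF s this] obtain \<theta> where \<theta>: "0 < \<theta>" "\<theta> < s"
    "u s - u 0 = s * (Df F (x + s *\<^sub>R k' + \<theta> *\<^sub>R h) h - Df F (x + \<theta> *\<^sub>R h) h)"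
    by auto
  have "class_C (Suc k) (\<lambda>y. Df F y h)"
    using assms(1) by simp
  from MVT2 [OF s class_C_has_real_derivative_line [OF this], of "x + \<theta> *\<^sub>R h" k']
  obtain \<theta>' where \<theta>': "0 < \<theta>'" "\<theta>' < s"
    "Df F (x + \<theta> *\<^sub>R h + s *\<^sub>R k') h - Df F (x + \<theta> *\<^sub>R h) h
      = s * Df (\<lambda>y. Df F y h) (x + \<theta> *\<^sub>R h + \<theta>' *\<^sub>R k') k'"
    by auto
  have "u s - u 0 = s\<^sup>2 * Df (\<lambda>y. Df F y h) (x + \<theta> *\<^sub>R h + \<theta>' *\<^sub>R k') k'"
    using \<theta>(3) \<theta>'(3) by (simp add: power2_eq_square add_ac)
  moreover have "u s - u 0 = F (x + s *\<^sub>R h + s *\<^sub>R k') - F (x + s *\<^sub>R h) - F (x + s *\<^sub>R k') + F x"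
    by (simp add: u_def add_ac)
  ultimately show ?thesis
    using \<theta> \<theta>' that by metis
qed

text \<open>Divided by \<open>s\<^sup>2\<close>, the same second difference is a value of either mixed derivative at points
  that tend to \<open>x\<close> as \<open>s\<close> tends to 0, so continuity makes the two limits equal.\<close>

theorem second_derivative_symmetric:
  fixes F :: "'a::euclidean_space \<Rightarrow> real"
  assumes C: "class_C (Suc (Suc k)) F"
  shows "Df (\<lambda>y. Df F y h) x k' = Df (\<lambda>y. Df F y k') x h"
proof (rule ccontr)
  define A where "A y = Df (\<lambda>y. Df F y h) y k'" for y
  define B where "B y = Df (\<lambda>y. Df F y k') y h" for y
  assume "\<not> ?thesis"
  then have ne: "A x \<noteq> B x" by (simp add: A_def B_def)
  define e where "e = \<bar>A x - B x\<bar> / 2"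
  have e: "e > 0" using ne by (simp add: e_def)
  have "continuous_on UNIV A" "continuous_on UNIV B"
    unfolding A_def B_def by (rule class_C_continuous [of k]; use C in simp)+
  then have "continuous (at x) A" "continuous (at x) B"
    by (auto simp: continuous_on_eq_continuous_at)
  then obtain d1 d2 where d: "d1 > 0" "d2 > 0"
    and A: "\<And>y. dist y x < d1 \<Longrightarrow> dist (A y) (A x) < e"
    and B: "\<And>y. dist y x < d2 \<Longrightarrow> dist (B y) (B x) < e"
    using e unfolding continuous_at_eps_delta by metis
  \<comment> \<open>small enough for the parallelogram at \<open>x\<close> with edges \<open>s h\<close> and \<open>s k'\<close> to lie in both neighbourhoods\<close>
  define s where "s = min d1 d2 / (2 * (norm h + norm k' + 1))"
  have pos: "norm h + norm k' + 1 > 0" by (smt (verit) norm_ge_zero)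
  have s: "s > 0" using d pos by (simp add: s_def)
  have "s * (norm h + norm k') < s * (2 * (norm h + norm k' + 1))"
    using s by (intro mult_strict_left_mono) (smt (verit) norm_ge_zero)+
  also have "\<dots> = min d1 d2" using pos by (simp add: s_def)
  finally have small: "s * (norm h + norm k') < min d1 d2" .
  have near: "dist (x + \<theta> *\<^sub>R h + \<theta>' *\<^sub>R k') x < min d1 d2"
    if "0 < \<theta>" "\<theta> < s" "0 < \<theta>'" "\<theta>' < s" for \<theta> \<theta>'
  proof -
    have "dist (x + \<theta> *\<^sub>R h + \<theta>' *\<^sub>R k') x = norm (\<theta> *\<^sub>R h + \<theta>' *\<^sub>R k')"
      by (simp add: dist_norm add.assoc)
    also have "\<dots> \<le> \<theta> * norm h + \<theta>' * norm k'"
      using that norm_triangle_ineq [of "\<theta> *\<^sub>R h" "\<theta>' *\<^sub>R k'"] by simp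
    also have "\<dots> \<le> s * (norm h + norm k')"
      unfolding distrib_left using that by (intro add_mono mult_right_mono) auto
    finally show ?thesis using small by linarith
  qed
  obtain \<theta> \<theta>' where 1: "0 < \<theta>" "\<theta> < s" "0 < \<theta>'" "\<theta>' < s"
    "F (x + s *\<^sub>R h + s *\<^sub>R k') - F (x + s *\<^sub>R h) - F (x + s *\<^sub>R k') + F x
      = s\<^sup>2 * A (x + \<theta> *\<^sub>R h + \<theta>' *\<^sub>R k')"
    unfolding A_def by (rule second_difference_mean_value [OF C s, of x h k'])
  obtain \<eta> \<eta>' where 2: "0 < \<eta>" "\<eta> < s" "0 < \<eta>'" "\<eta>' < s"
    "F (x + s *\<^sub>R k' + s *\<^sub>R h) - F (x + s *\<^sub>R k') - F (x + s *\<^sub>R h) + F x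
      = s\<^sup>2 * B (x + \<eta> *\<^sub>R k' + \<eta>' *\<^sub>R h)"
    unfolding B_def by (rule second_difference_mean_value [OF C s, of x k' h])
  have "s\<^sup>2 * A (x + \<theta> *\<^sub>R h + \<theta>' *\<^sub>R k') = s\<^sup>2 * B (x + \<eta>' *\<^sub>R h + \<eta> *\<^sub>R k')"
    using 1(5) 2(5) by (simp add: algebra_simps)
  then have "A (x + \<theta> *\<^sub>R h + \<theta>' *\<^sub>R k') = B (x + \<eta>' *\<^sub>R h + \<eta> *\<^sub>R k')"
    using s by simp
  moreover have "dist (A (x + \<theta> *\<^sub>R h + \<theta>' *\<^sub>R k')) (A x) < e"
    using A near [OF 1(1-4)] by simp
  moreover have "dist (B (x + \<eta>' *\<^sub>R h + \<eta> *\<^sub>R k')) (B x) < e"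
    using B near [OF 2(3,4,1,2)] by simp
  ultimately show False
    unfolding e_def dist_real_def by (simp add: abs_if split: if_splits)
qed

section \<open>Existence of solutions of ordinary differential equations\<close>

text \<open>The integral operator of the initial value problem is a contraction for the sup norm over a
  short time interval. To have it act on all bounded continuous functions on the real line, with no
  invariant set to maintain, the field is extended from the ball to a globally Lipschitz bounded
  field by composition with the nearest-point projection, and time is clamped to the interval. The interval
  is so short that the fixed point never leaves the ball, where the extension agrees with the given field.\<close>

lemma picard_lindeloef:
  fixes X :: "'a::euclidean_space \<Rightarrow> 'a"
  assumes lip: "K-lipschitz_on (cball x0 r) X" and r: "r > 0"
  obtains h x where "h > 0" "x t0 = x0"
    "\<And>t. t \<in> {t0-h<..<t0+h} \<Longrightarrow> (x has_vector_derivative X (x t)) (at t)"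
proof -
  define P where "P = closest_point (cball x0 r)"
  define Y where "Y = (\<lambda>x. X (P x))"
  have P_in: "P x \<in> cball x0 r" for x
    using r by (simp add: P_def closest_point_in_set del: mem_cball)
  have K: "K \<ge> 0" using lip by (rule lipschitz_on_nonneg)
  have Y_lip: "dist (Y x) (Y y) \<le> K * dist x y" for x y
  proof -
    have "dist (Y x) (Y y) \<le> K * dist (P x) (P y)"
      unfolding Y_def using lipschitz_onD [OF lip] P_in by blast
    also have "\<dots> \<le> K * dist x y"
      unfolding P_def using r K by (intro mult_left_mono closest_point_lipschitz) auto
    finally show ?thesis .
  qed
  have Y_cont: "continuous_on S Y" for S
  proof (rule lipschitz_on_continuous_on)
    show "K-lipschitz_on S Y"
      using Y_lip K by (intro lipschitz_onI) auto
  qed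
  define M where "M = norm (X x0) + K * r"
  have M: "M \<ge> 0" using K r by (simp add: M_def)
  have Y_bound: "norm (Y x) \<le> M" for x
  proof -
    have "dist (X (P x)) (X x0) \<le> K * dist (P x) x0"
      using lipschitz_onD [OF lip] P_in r by auto
    also have "\<dots> \<le> K * r"
      using P_in [of x] K by (intro mult_left_mono) (auto simp: dist_commute)
    finally show ?thesis
      unfolding Y_def M_def dist_norm using norm_triangle_sub [of "X (P x)" "X x0"] by linarith
  qed
  \<comment> \<open>The first bound makes the operator a contraction, the second keeps the solution within \<open>r\<close> of \<open>x0\<close>.\<close>
  define h where "h = min (1 / (2 * (K + 1))) (r / (M + 1))"
  have h: "h > 0" using K M r by (simp add: h_def)
  have Kh: "K * h \<le> 1 / 2"
  proof -
    have "K * h \<le> K * (1 / (2 * (K + 1)))"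
      using K by (intro mult_left_mono) (auto simp: h_def)
    also have "\<dots> \<le> 1/2" using K by (simp add: field_simps)
    finally show ?thesis .
  qed
  have Mh: "M * h \<le> r"
  proof -
    have "M * h \<le> M * (r / (M + 1))"
      using M by (intro mult_left_mono) (auto simp: h_def)
    also have "\<dots> \<le> r" using M r by (simp add: field_simps)
    finally show ?thesis .
  qed
  define J where "J = {t0-h..t0+h}"
  have t0J: "t0 \<in> J" using h by (simp add: J_def)
  have absJ: "\<bar>t - t0\<bar> \<le> h" if "t \<in> J" for t
    using that by (auto simp: J_def)
  \<comment> \<open>the integral from \<open>t0\<close> to \<open>t\<close>, written as a difference because \<open>t\<close> may precede \<open>t0\<close>\<close>
  define G where "G x t = x0 + (integral {t0-h..t} (\<lambda>s. Y (apply_bcontfun x s))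
      - integral {t0-h..t0} (\<lambda>s. Y (apply_bcontfun x s)))" for x :: "real \<Rightarrow>\<^sub>C 'a" and t
  have G_t0: "G x t0 = x0" for x by (simp add: G_def)
  have Yx_cont: "continuous_on S (\<lambda>s. Y (apply_bcontfun x s))" for S and x :: "real \<Rightarrow>\<^sub>C 'a"
    by (rule continuous_on_compose2 [OF Y_cont [of UNIV]]) auto
  have G_deriv: "(G x has_vector_derivative Y (apply_bcontfun x t)) (at t within J)"
    if "t \<in> J" for x t
    unfolding G_def J_def
    by (rule derivative_eq_intros integral_has_vector_derivative [OF Yx_cont] refl
        | use that in \<open>simp add: J_def\<close>)+
  \<comment> \<open>This gives both the boundedness of \<open>G x\<close> and, for differences, the contraction estimate.\<close>
  have bound: "norm (g t - g t0) \<le> B * h"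
    if "\<And>t. t \<in> J \<Longrightarrow> (g has_vector_derivative g' t) (at t within J)"
      and "\<And>t. norm (g' t) \<le> B" and t: "t \<in> J" for g g' :: "real \<Rightarrow> 'a" and B t
  proof -
    have B: "B \<ge> 0" using that(2) norm_ge_zero order_trans by blast
    have "norm (g t - g t0) \<le> B * norm (t - t0)"
    proof (rule differentiable_bound [of J])
      show "convex J" by (simp add: J_def)
      show "(g has_derivative (\<lambda>s. s *\<^sub>R g' t)) (at t within J)" if "t \<in> J" for t
        using \<open>\<And>t. t \<in> J \<Longrightarrow> (g has_vector_derivative g' t) (at t within J)\<close> [OF that]
        by (simp add: has_vector_derivative_def)
      show "onorm (\<lambda>s. s *\<^sub>R g' t) \<le> B" for t
        by (rule onorm_le)
          (use that(2) [of t] in \<open>simp add: mult.commute [of B] mult_left_mono\<close>)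
    qed (use t t0J in auto)
    also have "\<dots> \<le> B * h"
      using absJ [OF t] B by (simp add: mult_left_mono)
    finally show ?thesis .
  qed
  have G_bound: "norm (G x t - x0) \<le> M * h" if "t \<in> J" for x t
    using bound [of "G x" "\<lambda>t. Y (apply_bcontfun x t)" M t] G_deriv Y_bound that by (simp add: G_t0)
  define c where "c = clamp (t0-h) (t0+h)"
  have c_in: "c t \<in> J" for t
    using h clamp_in_interval [of "t0-h" "t0+h" t] by (simp add: c_def J_def)
  have c_id: "c t = t" if "t \<in> J" for t
    using that by (simp add: c_def J_def)
  have "(\<lambda>t. G x (c t)) \<in> bcontfun" for x
  proof (rule bcontfun_normI)
    have "continuous_on J (G x)"
      using G_deriv has_vector_derivative_continuous by (fastforce simp: continuous_on_eq_continuous_within)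
    then show "continuous_on UNIV (\<lambda>t. G x (c t))"
      unfolding c_def by (intro clamp_continuous_on) (simp add: J_def)
    show "norm (G x (c t)) \<le> norm x0 + M * h" for t
      using G_bound [OF c_in] norm_triangle_sub [of "G x (c t)" x0] by (meson add_left_mono order_trans)
  qed
  then have "\<forall>x. \<exists>y. apply_bcontfun y = (\<lambda>t. G x (c t))"
    by (metis bcontfunE)
  then obtain T where T: "\<And>x t. apply_bcontfun (T x) t = G x (c t)"
    by metis
  have "dist (T x) (T y) \<le> 1 / 2 * dist x y" for x y
  proof (rule dist_bound)
    fix t
    have "norm ((G x (c t) - G y (c t)) - (G x t0 - G y t0)) \<le> (K * dist x y) * h"
    proof (rule bound [OF _ _ c_in])
      show "((\<lambda>t. G x t - G y t) has_vector_derivative Y (apply_bcontfun x t) - Y (apply_bcontfun y t)) (at t within J)"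
        if "t \<in> J" for t
        by (intro has_vector_derivative_diff G_deriv that)
      show "norm (Y (apply_bcontfun x t) - Y (apply_bcontfun y t)) \<le> K * dist x y" for t
        using Y_lip [of "apply_bcontfun x t" "apply_bcontfun y t"]
          mult_left_mono [OF dist_bounded [of x t y] K] by (simp add: dist_norm)
    qed
    also have "\<dots> = (K * h) * dist x y" by simp
    also have "\<dots> \<le> 1 / 2 * dist x y"
      using Kh by (intro mult_right_mono) auto
    finally show "dist (apply_bcontfun (T x) t) (apply_bcontfun (T y) t) \<le> 1 / 2 * dist x y"
      by (simp add: T G_t0 dist_norm)
  qed
  then obtain x where x: "T x = x"
    using banach_fix_type [of "1/2" T] by auto
  have x_eq: "apply_bcontfun x t = G x t" if "t \<in> J" for t
    using T [of x t] x c_id [OF that] by simp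
  show ?thesis
  proof (rule that [of h "apply_bcontfun x"])
    show "h > 0" by fact
    show "apply_bcontfun x t0 = x0" by (simp add: x_eq t0J G_t0)
    fix t assume t: "t \<in> {t0-h<..<t0+h}"
    then have tJ: "t \<in> J" by (simp add: J_def)
    have "norm (G x t - x0) \<le> M * h"
      by (rule G_bound [OF tJ])
    then have "apply_bcontfun x t \<in> cball x0 r"
      using Mh x_eq [OF tJ] by (simp add: dist_norm norm_minus_commute)
    then have "Y (apply_bcontfun x t) = X (apply_bcontfun x t)"
      by (simp add: Y_def P_def closest_point_self)
    moreover have "(apply_bcontfun x has_vector_derivative Y (apply_bcontfun x t)) (at t within J)"
      using has_vector_derivative_transform [OF tJ x_eq G_deriv [OF tJ]] .
    moreover have "at t within J = at t"
      using t by (intro at_within_interior) (simp add: J_def)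
    ultimately show "(apply_bcontfun x has_vector_derivative X (apply_bcontfun x t)) (at t)"
      by simp
  qed
qed

text \<open>The reason is the identity \<open>A x (X x - X y) = (b x - b y) - (A x - A y) (X y)\<close>, together with a lower
  bound \<open>norm (A x w) \<ge> (c / 2) norm w\<close> that persists near \<open>x0\<close>. It gives the regularity of \<open>X\<close>
  without differentiating matrix inverses.\<close>

lemma lipschitz_linear_solution:
  fixes A :: "'a::metric_space \<Rightarrow> 'b::euclidean_space \<Rightarrow> 'b"
  assumes r: "r > 0"
    and lin: "\<And>x. linear (A x)"
    and inj: "inj (A x0)"
    and A_lip: "\<And>x y w. x \<in> cball x0 r \<Longrightarrow> y \<in> cball x0 r \<Longrightarrow> norm (A x w - A y w) \<le> KA * dist x y * norm w"
    and b_lip: "Kb-lipschitz_on (cball x0 r) b"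
    and sol: "\<And>x. A x (X x) = b x"
  obtains \<rho> K where "\<rho> > 0" "K-lipschitz_on (cball x0 \<rho>) X"
proof -
  obtain c where c: "c > 0" "\<And>w. c * norm w \<le> norm (A x0 w)"
    using linear_inj_bounded_below_pos [OF lin inj] by metis
  \<comment> \<open>so small that \<open>A x\<close> differs from \<open>A x0\<close> by at most half the lower bound \<open>c\<close>\<close>
  define \<rho> where "\<rho> = min r (c / (2 * (\<bar>KA\<bar> + 1)))"
  have \<rho>: "\<rho> > 0" "\<rho> \<le> r" using r c by (auto simp: \<rho>_def)
  have KA\<rho>: "\<bar>KA\<bar> * \<rho> \<le> c / 2"
  proof -
    have "\<bar>KA\<bar> * \<rho> \<le> \<bar>KA\<bar> * (c / (2 * (\<bar>KA\<bar> + 1)))"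
      by (intro mult_left_mono) (auto simp: \<rho>_def)
    also have "\<dots> \<le> c / 2" using c by (simp add: field_simps)
    finally show ?thesis .
  qed
  have A_lip': "norm (A x w - A y w) \<le> \<bar>KA\<bar> * dist x y * norm w"
    if "x \<in> cball x0 r" "y \<in> cball x0 r" for x y w
    using A_lip [OF that, of w] by (smt (verit) mult_right_mono norm_ge_zero zero_le_dist)
  have below: "c / 2 * norm w \<le> norm (A x w)" if x: "x \<in> cball x0 \<rho>" for x w
  proof -
    have "norm (A x0 w - A x w) \<le> \<bar>KA\<bar> * dist x0 x * norm w"
      using x \<rho> r by (intro A_lip') auto
    also have "\<dots> \<le> \<bar>KA\<bar> * \<rho> * norm w"
      using x by (intro mult_right_mono mult_left_mono) auto
    also have "\<dots> \<le> c / 2 * norm w"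
      using KA\<rho> by (intro mult_right_mono) auto
    finally show ?thesis
      using c(2) [of w] norm_triangle_sub [of "A x0 w" "A x w"] by simp
  qed
  have Kb: "Kb \<ge> 0" using b_lip by (rule lipschitz_on_nonneg)
  define M where "M = 2 / c * (norm (b x0) + Kb * \<rho>)"
  have X_bound: "norm (X y) \<le> M" if y: "y \<in> cball x0 \<rho>" for y
  proof -
    have "c / 2 * norm (X y) \<le> norm (b y)"
      using below [OF y, of "X y"] by (simp add: sol)
    also have "norm (b y) \<le> norm (b x0) + norm (b y - b x0)"
      by (rule norm_triangle_sub)
    also have "norm (b y - b x0) \<le> Kb * dist y x0"
      using lipschitz_onD [OF b_lip, of y x0] y \<rho> r by (auto simp: dist_norm)
    also have "\<dots> \<le> Kb * \<rho>"
      using y Kb by (intro mult_left_mono) (auto simp: dist_commute)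
    finally show ?thesis using c by (simp add: M_def field_simps)
  qed
  have M: "M \<ge> 0" using X_bound [of x0] \<rho> norm_ge_zero order_trans by (metis centre_in_cball less_imp_le)
  have "(2 / c * (Kb + \<bar>KA\<bar> * M))-lipschitz_on (cball x0 \<rho>) X"
  proof (rule lipschitz_onI)
    fix x y assume xy: "x \<in> cball x0 \<rho>" "y \<in> cball x0 \<rho>"
    then have xy': "x \<in> cball x0 r" "y \<in> cball x0 r" using \<rho> by auto
    have "A x (X x - X y) = (b x - b y) - (A x (X y) - A y (X y))"
      by (simp add: linear_diff [OF lin] sol)
    then have "c / 2 * norm (X x - X y) \<le> norm ((b x - b y) - (A x (X y) - A y (X y)))"
      using below [OF xy(1), of "X x - X y"] by simp
    also have "\<dots> \<le> norm (b x - b y) + norm (A x (X y) - A y (X y))"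
      by (rule norm_triangle_ineq4)
    also have "\<dots> \<le> Kb * dist x y + \<bar>KA\<bar> * dist x y * M"
    proof (rule add_mono)
      show "norm (b x - b y) \<le> Kb * dist x y"
        using lipschitz_onD [OF b_lip xy'] by (simp add: dist_norm)
      have "norm (A x (X y) - A y (X y)) \<le> \<bar>KA\<bar> * dist x y * norm (X y)"
        by (rule A_lip' [OF xy'])
      also have "\<dots> \<le> \<bar>KA\<bar> * dist x y * M"
        using X_bound [OF xy(2)] by (intro mult_left_mono) auto
      finally show "norm (A x (X y) - A y (X y)) \<le> \<bar>KA\<bar> * dist x y * M" .
    qed
    finally show "dist (X x) (X y) \<le> 2 / c * (Kb + \<bar>KA\<bar> * M) * dist x y"
      using c by (simp add: dist_norm field_simps)
  qed (use c Kb M in auto)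
  with \<rho> that show thesis by blast
qed

section \<open>Partial derivatives of functions on phase space\<close>

type_synonym 'n phase_space = "real \<times> (real ^ 'n) \<times> (real ^ 'n)"

text \<open>The uncurried form of a phase function, which is the one that has a derivative in all
  variables together. Every partial derivative is a value of this derivative.\<close>

abbreviation phase :: "('n::finite, 'b::real_normed_vector) phase_fun \<Rightarrow> 'n phase_space \<Rightarrow> 'b" where
  "phase F \<equiv> (\<lambda>(t, q, v). F t q v)"

lemma inner_gradient:
  fixes \<phi> :: "'a::euclidean_space \<Rightarrow> real"
  assumes "(\<phi> has_derivative \<phi>') (at x)"
  shows "gradient \<phi> x \<bullet> h = \<phi>' h"
proof -
  have eq: "\<phi>' = (\<lambda>h. h \<bullet> (\<Sum>b\<in>Basis. \<phi>' b *\<^sub>R b))"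
  proof
    fix h
    have "\<phi>' h = \<phi>' (\<Sum>b\<in>Basis. (h \<bullet> b) *\<^sub>R b)"
      by (simp add: euclidean_representation)
    also have "\<dots> = h \<bullet> (\<Sum>b\<in>Basis. \<phi>' b *\<^sub>R b)"
      using has_derivative_linear [OF assms]
      by (simp add: linear_sum linear_cmul inner_sum_right mult.commute)
    finally show "\<phi>' h = h \<bullet> (\<Sum>b\<in>Basis. \<phi>' b *\<^sub>R b)" .
  qed
  have "gradient \<phi> x = (\<Sum>b\<in>Basis. \<phi>' b *\<^sub>R b)"
    unfolding gradient_def
  proof (rule the_equality)
    show "GDERIV \<phi> x :> (\<Sum>b\<in>Basis. \<phi>' b *\<^sub>R b)"
      using assms eq by (simp add: gderiv_def)
    fix D assume "GDERIV \<phi> x :> D"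
    then have "\<phi>' = (\<lambda>h. h \<bullet> D)"
      unfolding gderiv_def using assms has_derivative_unique by blast
    with eq show "D = (\<Sum>b\<in>Basis. \<phi>' b *\<^sub>R b)"
      by (metis vector_eq_ldot)
  qed
  with eq show ?thesis by (metis inner_commute)
qed

context
  fixes F :: "('n::finite, 'b::real_normed_vector) phase_fun" and t q v
  assumes diff: "phase F differentiable (at (t, q, v))"
begin

lemma phase_has_derivative:
  "(phase F has_derivative Df (phase F) (t, q, v)) (at (t, q, v))"
  using diff by (simp add: frechet_derivative_works [symmetric])

lemma linear_Df_phase: "linear (Df (phase F) (t, q, v))"
  by (rule has_derivative_linear [OF phase_has_derivative])

lemma has_derivative_q:
  "((\<lambda>x. F t x v) has_derivative (\<lambda>h. Df (phase F) (t, q, v) (0, h, 0))) (at q)"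
proof -
  have "((\<lambda>x. (t, x, v)) has_derivative (\<lambda>h. (0, h, 0))) (at q)"
    by (intro has_derivative_Pair has_derivative_ident has_derivative_const)
  from has_derivative_compose [OF this phase_has_derivative] show ?thesis by simp
qed

lemma has_derivative_v:
  "((\<lambda>x. F t q x) has_derivative (\<lambda>h. Df (phase F) (t, q, v) (0, 0, h))) (at v)"
proof -
  have "((\<lambda>x. (t, q, x)) has_derivative (\<lambda>h. (0, 0, h))) (at v)"
    by (intro has_derivative_Pair has_derivative_ident has_derivative_const)
  from has_derivative_compose [OF this phase_has_derivative] show ?thesis by simp
qed

lemma partial_t_eq: "partial_t F t q v = Df (phase F) (t, q, v) (1, 0, 0)"
proof -
  have "((\<lambda>s. (s, q, v)) has_derivative (\<lambda>h. (h, 0, 0))) (at t)"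
    by (intro has_derivative_Pair has_derivative_ident has_derivative_const)
  from has_derivative_compose [OF this phase_has_derivative]
  have "((\<lambda>s. F s q v) has_derivative (\<lambda>h. Df (phase F) (t, q, v) (h, 0, 0))) (at t)"
    by simp
  also have "(\<lambda>h. Df (phase F) (t, q, v) (h, 0, 0)) = (\<lambda>h. h *\<^sub>R Df (phase F) (t, q, v) (1, 0, 0))"
  proof
    show "Df (phase F) (t, q, v) (h, 0, 0) = h *\<^sub>R Df (phase F) (t, q, v) (1, 0, 0)" for h
      using linear_cmul [OF linear_Df_phase, of h "(1, 0, 0)"] by simp
  qed
  finally show ?thesis
    unfolding partial_t_def has_vector_derivative_def [symmetric] by (rule vector_derivative_at)
qed

lemma Df_phase_split:
  "Df (phase F) (t, q, v) (s, h, w) =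
     s *\<^sub>R Df (phase F) (t, q, v) (1, 0, 0) + Df (phase F) (t, q, v) (0, h, 0)
       + Df (phase F) (t, q, v) (0, 0, w)"
  using linear_add [OF linear_Df_phase, of "(s, h, 0)" "(0, 0, w)"]
    linear_add [OF linear_Df_phase, of "(s, 0, 0)" "(0, h, 0)"]
    linear_cmul [OF linear_Df_phase, of s "(1, 0, 0)"]
  by simp

lemma total_deriv_eq: "total_deriv F t q v a = Df (phase F) (t, q, v) (1, v, a)"
  unfolding total_deriv_def partial_t_eq Df_eqI [OF has_derivative_q] Df_eqI [OF has_derivative_v]
  by (subst (4) Df_phase_split) simp

end

lemma inner_grad_q:
  "phase F differentiable (at (t, q, v)) \<Longrightarrow> grad_q F t q v \<bullet> h = Df (phase F) (t, q, v) (0, h, 0)"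
  unfolding grad_q_def by (rule inner_gradient [OF has_derivative_q])

lemma inner_grad_v:
  "phase F differentiable (at (t, q, v)) \<Longrightarrow> grad_v F t q v \<bullet> h = Df (phase F) (t, q, v) (0, 0, h)"
  unfolding grad_v_def by (rule inner_gradient [OF has_derivative_v])

lemma class_C_grad_q:
  assumes "class_C (Suc k) (phase F)"
  shows "class_C k (phase (grad_q F))"
proof (rule class_C_componentwise)
  fix b :: "real ^ 'a"
  have "(\<lambda>x. phase (grad_q F) x \<bullet> b) = (\<lambda>x. Df (phase F) x (0, b, 0))"
    using class_C_differentiable [OF assms] by (auto simp: inner_grad_q)
  with assms show "class_C k (\<lambda>x. phase (grad_q F) x \<bullet> b)" by simp
qed

lemma class_C_grad_v:
  assumes "class_C (Suc k) (phase F)"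
  shows "class_C k (phase (grad_v F))"
proof (rule class_C_componentwise)
  fix b :: "real ^ 'a"
  have "(\<lambda>x. phase (grad_v F) x \<bullet> b) = (\<lambda>x. Df (phase F) x (0, 0, b))"
    using class_C_differentiable [OF assms] by (auto simp: inner_grad_v)
  with assms show "class_C k (\<lambda>x. phase (grad_v F) x \<bullet> b)" by simp
qed

lemma hessian_v_vector_mult:
  assumes "phase (grad_v L) differentiable (at (t, q, v))"
  shows "hessian_v L t q v *v a = Df (phase (grad_v L)) (t, q, v) (0, 0, a)"
proof -
  note der = has_derivative_v [OF assms]
  have "grad_v L t q differentiable (at v)"
    using der by (auto simp: differentiable_def)
  then have "(grad_v L t q has_derivative (*v) (hessian_v L t q v)) (at v)"
    unfolding hessian_v_def by (simp add: jacobian_works)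
  with der have "(*v) (hessian_v L t q v) = (\<lambda>h. Df (phase (grad_v L)) (t, q, v) (0, 0, h))"
    by (rule has_derivative_unique [rotated])
  then show ?thesis by (rule fun_cong)
qed

text \<open>Both sides are second derivatives of \<open>L\<close> along the vectors \<open>(0, 0, a)\<close> and \<open>(0, 0, b)\<close>, taken
  in opposite order.\<close>

lemma hessian_v_symmetric:
  assumes "class_C (Suc (Suc k)) (phase L)"
  shows "(hessian_v L t q v *v a) \<bullet> b = a \<bullet> (hessian_v L t q v *v b)"
proof -
  note C = class_C_grad_v [OF assms]
  have "(hessian_v L t q v *v a) \<bullet> b
      = Df (\<lambda>x. Df (phase L) x (0, 0, b)) (t, q, v) (0, 0, a)" for a b
  proof -
    have eq: "(\<lambda>x. phase (grad_v L) x \<bullet> b) = (\<lambda>x. Df (phase L) x (0, 0, b))"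
      using class_C_differentiable [OF assms] by (auto simp: inner_grad_v)
    have "((\<lambda>x. phase (grad_v L) x \<bullet> b) has_derivative
        (\<lambda>h. Df (phase (grad_v L)) (t, q, v) h \<bullet> b)) (at (t, q, v))"
      by (rule has_derivative_inner_left [OF class_C_has_derivative [OF C]])
    then show ?thesis
      unfolding eq by (simp add: Df_eqI hessian_v_vector_mult [OF class_C_differentiable [OF C]])
  qed
  with second_derivative_symmetric [OF assms] show ?thesis
    by (metis inner_commute)
qed

lemma matrix_inv_cancel:
  fixes A :: "real ^ 'n ^ 'n"
  assumes "det A \<noteq> 0"
  shows "A *v (matrix_inv A *v x) = x" "matrix_inv A *v (A *v x) = x"
proof -
  have "\<exists>B. A ** B = mat 1 \<and> B ** A = mat 1"
    using assms by (simp add: invertible_det_nz [symmetric] invertible_def)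
  then have "A ** matrix_inv A = mat 1 \<and> matrix_inv A ** A = mat 1"
    unfolding matrix_inv_def by (rule someI_ex)
  then show "A *v (matrix_inv A *v x) = x" "matrix_inv A *v (A *v x) = x"
    by (simp_all add: matrix_vector_mul_assoc)
qed

section \<open>The Lagrange equation in normal form\<close>

text \<open>The function \<open>\<Lambda>\<close> of the normal form. The derivative of \<open>grad_v L\<close> in the direction \<open>(1, v, 0)\<close>
  collects the mixed derivatives in \<open>(t, v)\<close> and in \<open>(q, v)\<close>.\<close>

definition acceleration :: "('n::finite, real) phase_fun \<Rightarrow> ('n, real ^ 'n) phase_fun" where
  "acceleration L t q v = matrix_inv (hessian_v L t q v) *v
     (grad_q L t q v - Df (phase (grad_v L)) (t, q, v) (1, v, 0))"

context
  fixes L :: "('n::finite, real) phase_fun"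
  assumes L: "class_C 3 (phase L)" and det: "\<And>t q v. det (hessian_v L t q v) \<noteq> 0"
begin

private lemma class_C_3_L: "class_C (Suc (Suc (Suc 0))) (phase L)"
  using L by (simp only: numeral_3_eq_3)

private lemma class_C_2_grad_v: "class_C (Suc (Suc 0)) (phase (grad_v L))"
  by (rule class_C_grad_v [OF class_C_3_L])

text \<open>The Lagrange equation off shell: the momentum \<open>grad_v L\<close> changes at the rate \<open>grad_q L\<close>
  exactly when \<open>a\<close> is the acceleration, since the Hessian is invertible.\<close>

lemma Df_grad_v:
  "Df (phase (grad_v L)) (t, q, v) (1, v, a)
     = grad_q L t q v + hessian_v L t q v *v (a - acceleration L t q v)"
proof -
  have "Df (phase (grad_v L)) (t, q, v) (1, v, a)
      = Df (phase (grad_v L)) (t, q, v) (1, v, 0) + hessian_v L t q v *v a"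
    using linear_add [OF linear_Df_phase [OF class_C_differentiable [OF class_C_2_grad_v]], of t q v "(1, v, 0)" "(0, 0, a)"]
    by (simp add: hessian_v_vector_mult [OF class_C_differentiable [OF class_C_2_grad_v]])
  then show ?thesis
    by (simp add: acceleration_def matrix_vector_mult_diff_distrib matrix_inv_cancel [OF det])
qed

text \<open>The autonomous field on phase space, time included, whose integral curves are, up to a
  shift of the parameter, the lifted solutions of the Lagrange equation.\<close>

definition spray :: "'n phase_space \<Rightarrow> 'n phase_space" where
  "spray = (\<lambda>(t, q, v). (1, v, acceleration L t q v))"

text \<open>The field \<open>(1, v, \<Lambda>)\<close> solves the linear system whose first two components fix it to \<open>(1, v)\<close> and
  whose third is the Lagrange equation, that the derivative of \<open>grad_v L\<close> along it is \<open>grad_q L\<close>. The system is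
  injective because the Hessian is.\<close>

lemma spray_locally_lipschitz:
  obtains r K where "r > 0" "K-lipschitz_on (cball x0 r) spray"
proof -
  define A :: "'n phase_space \<Rightarrow> 'n phase_space \<Rightarrow> 'n phase_space"
    where "A x w = (fst w, fst (snd w), Df (phase (grad_v L)) x w)" for x w
  define b :: "'n phase_space \<Rightarrow> 'n phase_space"
    where "b x = (1, snd (snd x), phase (grad_q L) x)" for x
  obtain KA where KA: "\<And>x y w. x \<in> cball x0 1 \<Longrightarrow> y \<in> cball x0 1 \<Longrightarrow>
      norm (Df (phase (grad_v L)) x w - Df (phase (grad_v L)) y w) \<le> KA * dist x y * norm w"
    using class_C_Df_lipschitz_on_cball [OF class_C_2_grad_v] by metis
  obtain KQ where KQ: "KQ-lipschitz_on (cball x0 1) (phase (grad_q L))"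
    using class_C_lipschitz_on_cball [OF class_C_grad_q [OF class_C_3_L]] by metis
  have "1-lipschitz_on (cball x0 1) (\<lambda>x. snd (snd x))"
    by (rule lipschitz_onI) (auto intro: order_trans [OF dist_snd_le])
  then obtain Kb where Kb: "Kb-lipschitz_on (cball x0 1) b"
    unfolding b_def using lipschitz_on_Pair [OF lipschitz_on_constant lipschitz_on_Pair [OF _ KQ]] by blast
  show thesis
  proof (rule lipschitz_linear_solution [of 1 A x0 KA Kb b spray])
    show linear_A: "linear (A x)" for x
    proof -
      have lin: "linear (Df (phase (grad_v L)) x)"
        by (rule has_derivative_linear [OF class_C_has_derivative [OF class_C_2_grad_v]])
      show ?thesis
        unfolding A_def by (intro linearI) (simp_all add: linear_add [OF lin] linear_cmul [OF lin])
    qed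
    show "inj (A x0)"
      unfolding linear_injective_0 [OF linear_A]
    proof (intro allI impI)
      obtain t q v where x0: "x0 = (t, q, v)" by (cases x0)
      fix w assume "A x0 w = 0"
      then obtain a where w: "w = (0, 0, a)" and "Df (phase (grad_v L)) x0 (0, 0, a) = 0"
        by (cases w) (auto simp: A_def zero_prod_def)
      then have "hessian_v L t q v *v a = 0"
        by (simp add: x0 hessian_v_vector_mult [OF class_C_differentiable [OF class_C_2_grad_v]])
      then have "a = 0"
        by (metis matrix_inv_cancel(2) [OF det] matrix_vector_mult_0_right)
      with w show "w = 0" by (simp add: zero_prod_def)
    qed
    show "norm (A x w - A y w) \<le> KA * dist x y * norm w"
      if "x \<in> cball x0 1" "y \<in> cball x0 1" for x y w
      using KA [OF that, of w] by (simp add: A_def norm_Pair)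
    show "A x (spray x) = b x" for x
      by (cases x) (simp add: A_def b_def spray_def Df_grad_v)
  qed (use Kb that in auto)
qed

lemma lagrange_solution_exists:
  obtains h c u where "h > 0" "c t0 = q0" "u t0 = v0"
    "lagrange_solution L {t0-h<..<t0+h} c u"
    "\<And>t. t \<in> {t0-h<..<t0+h} \<Longrightarrow> (u has_vector_derivative acceleration L t (c t) (u t)) (at t)"
proof -
  obtain r K where "r > 0" "K-lipschitz_on (cball (t0, q0, v0) r) spray"
    by (rule spray_locally_lipschitz)
  then obtain h x where h: "h > 0" and x0: "x t0 = (t0, q0, v0)"
    and x: "\<And>t. t \<in> {t0-h<..<t0+h} \<Longrightarrow> (x has_vector_derivative spray (x t)) (at t)"
    by (metis picard_lindeloef)
  define c where "c t = fst (snd (x t))" for t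
  define u where "u t = snd (snd (x t))" for t
  note fst_der = bounded_linear.has_vector_derivative [OF bounded_linear_fst]
  note snd_der = bounded_linear.has_vector_derivative [OF bounded_linear_snd]
  \<comment> \<open>The time component has derivative 1 and starts at \<open>t0\<close>.\<close>
  have time: "fst (x t) = t" if t: "t \<in> {t0-h<..<t0+h}" for t
  proof -
    have "((\<lambda>s. fst (x s) - s) has_derivative (\<lambda>_. 0)) (at s within {t0-h<..<t0+h})"
      if "s \<in> {t0-h<..<t0+h}" for s
    proof -
      have "((\<lambda>s. fst (x s) - s) has_vector_derivative 1 - 1) (at s)"
        using fst_der [OF x [OF that]]
        by (intro has_vector_derivative_diff has_vector_derivative_id) (simp add: spray_def split_beta)
      then show ?thesis
        by (simp add: has_vector_derivative_def has_derivative_at_withinI)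
    qed
    from has_derivative_zero_unique [OF _ this t, of t0] h x0 show ?thesis by simp
  qed
  have c: "(c has_vector_derivative u t) (at t)" if "t \<in> {t0-h<..<t0+h}" for t
    using fst_der [OF snd_der [OF x [OF that]]] by (simp add: c_def [abs_def] u_def spray_def split_beta)
  have u: "(u has_vector_derivative acceleration L t (c t) (u t)) (at t)" if "t \<in> {t0-h<..<t0+h}" for t
    using snd_der [OF snd_der [OF x [OF that]]] time [OF that]
    by (simp add: c_def u_def [abs_def] spray_def split_beta)
  have "lagrange_solution L {t0-h<..<t0+h} c u"
    unfolding lagrange_solution_def
  proof (intro ballI conjI)
    fix t assume t: "t \<in> {t0-h<..<t0+h}"
    show "u differentiable (at t)"
      using u [OF t] by (rule differentiableI_vector)
    have "((\<lambda>s. (s, c s, u s)) has_vector_derivative (1, u t, acceleration L t (c t) (u t))) (at t)"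
      by (intro has_vector_derivative_Pair has_vector_derivative_id c u t)
    from vector_derivative_diff_chain_within [OF this has_derivative_at_withinI
        [OF class_C_has_derivative [OF class_C_2_grad_v]]]
    show "((\<lambda>s. grad_v L s (c s) (u s)) has_vector_derivative grad_q L t (c t) (u t)) (at t)"
      by (simp add: o_def Df_grad_v)
  qed (rule c)
  show thesis
  proof (rule that [of h c u])
    show "c t0 = q0" "u t0 = v0" using x0 by (simp_all add: c_def u_def)
  qed fact+
qed

text \<open>Along the solution through \<open>(t, q, v)\<close> the function \<open>N\<close> is constant, and by the chain rule its time
  derivative at \<open>t\<close> is the derivative of \<open>N\<close> in the direction \<open>(1, v, \<Lambda>)\<close>.\<close>

lemma first_integral_imp_Df_eq_0:
  assumes N: "class_C (Suc k) (phase N)" and "first_integral L N"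
  shows "Df (phase N) (t, q, v) (1, v, acceleration L t q v) = 0"
proof -
  obtain h c u where h: "h > 0" and init: "c t = q" "u t = v"
    and sol: "lagrange_solution L {t-h<..<t+h} c u"
    and u: "(u has_vector_derivative acceleration L t (c t) (u t)) (at t)"
    by (rule lagrange_solution_exists [of t q v]) auto
  have c: "(c has_vector_derivative u t) (at t)"
    using sol h by (simp add: lagrange_solution_def)
  have "((\<lambda>s. (s, c s, u s)) has_vector_derivative (1, u t, acceleration L t (c t) (u t))) (at t)"
    by (intro has_vector_derivative_Pair has_vector_derivative_id c u)
  from vector_derivative_diff_chain_within [OF this has_derivative_at_withinI
      [OF class_C_has_derivative [OF N]]]
  have der: "((\<lambda>s. N s (c s) (u s)) has_vector_derivative
      Df (phase N) (t, q, v) (1, v, acceleration L t q v)) (at t)"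
    by (simp add: o_def init)
  have "(\<lambda>s. N s (c s) (u s)) constant_on {t-h<..<t+h}"
    using assms(2) sol unfolding first_integral_def
    by (meson is_interval_oo open_greaterThanLessThan)
  then obtain y where "\<And>s. s \<in> {t-h<..<t+h} \<Longrightarrow> N s (c s) (u s) = y"
    by (auto simp: constant_on_def)
  then have "((\<lambda>s. N s (c s) (u s)) has_vector_derivative 0) (at t)"
    using h by (intro has_vector_derivative_transform_within_open
        [OF has_vector_derivative_const [of y], where S="{t-h<..<t+h}"]) auto
  with der show ?thesis
    by (rule vector_derivative_unique_at)
qed

end

section \<open>The Killing-type equation\<close>

lemma total_deriv_associated_integral:
  assumes L: "class_C (Suc (Suc k)) (phase L)" and \<tau>: "class_C (Suc i) (phase \<tau>)"
    and \<xi>: "class_C (Suc j) (phase \<xi>)" and f: "class_C (Suc l) (phase f)"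
  shows "total_deriv (associated_integral L \<tau> \<xi> f) t q v a =
    total_deriv f t q v a - (L t q v * total_deriv \<tau> t q v a + total_deriv L t q v a * \<tau> t q v)
      - (grad_v L t q v \<bullet> (total_deriv \<xi> t q v a - (\<tau> t q v *\<^sub>R a + total_deriv \<tau> t q v a *\<^sub>R v))
         + total_deriv (grad_v L) t q v a \<bullet> (\<xi> t q v - \<tau> t q v *\<^sub>R v))"
proof -
  note P = class_C_grad_v [OF L]
  have eq: "phase (associated_integral L \<tau> \<xi> f) =
    (\<lambda>x. phase f x - phase L x * phase \<tau> x - phase (grad_v L) x \<bullet> (phase \<xi> x - phase \<tau> x *\<^sub>R snd (snd x)))"
    by (auto simp: associated_integral_def)
  have "(phase (associated_integral L \<tau> \<xi> f) has_derivative
    (\<lambda>h. Df (phase f) (t, q, v) h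
      - (L t q v * Df (phase \<tau>) (t, q, v) h + Df (phase L) (t, q, v) h * \<tau> t q v)
      - (grad_v L t q v \<bullet> (Df (phase \<xi>) (t, q, v) h
            - (\<tau> t q v *\<^sub>R snd (snd h) + Df (phase \<tau>) (t, q, v) h *\<^sub>R v))
         + Df (phase (grad_v L)) (t, q, v) h \<bullet> (\<xi> t q v - \<tau> t q v *\<^sub>R v)))) (at (t, q, v))"
    unfolding eq
    by (rule derivative_eq_intros class_C_has_derivative [OF L] class_C_has_derivative [OF P]
        class_C_has_derivative [OF \<tau>] class_C_has_derivative [OF \<xi>] class_C_has_derivative [OF f] refl)+ simp
  then show ?thesis
    by (subst total_deriv_eq) (auto simp: Df_eqI differentiable_def
        total_deriv_eq [OF class_C_differentiable [OF L]] total_deriv_eq [OF class_C_differentiable [OF P]]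
        total_deriv_eq [OF class_C_differentiable [OF \<tau>]] total_deriv_eq [OF class_C_differentiable [OF \<xi>]]
        total_deriv_eq [OF class_C_differentiable [OF f]])
qed

lemma total_deriv_eq_gradients:
  assumes "phase F differentiable (at (t, q, v))"
  shows "total_deriv F t q v a = partial_t F t q v + grad_q F t q v \<bullet> v + grad_v F t q v \<bullet> a"
  by (simp add: total_deriv_eq [OF assms] partial_t_eq [OF assms] inner_grad_q [OF assms]
      inner_grad_v [OF assms] Df_phase_split [OF assms, of 1 v a])

text \<open>This holds whether or not \<open>(\<tau>, \<xi>, f)\<close> solves the equation: the terms with total derivatives of \<open>\<tau>\<close>, \<open>\<xi>\<close> and \<open>f\<close> are
  absorbed by the derivative of the associated integral, and the terms with \<open>a\<close> that come from \<open>L\<close> and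
  from \<open>\<tau> v\<close> cancel.\<close>

lemma killing_defect:
  assumes L: "class_C (Suc (Suc k)) (phase L)" and "class_C (Suc i) (phase \<tau>)"
    and "class_C (Suc j) (phase \<xi>)" and "class_C (Suc l) (phase f)"
  shows "\<tau> t q v * partial_t L t q v + grad_q L t q v \<bullet> \<xi> t q v
        + grad_v L t q v \<bullet> (total_deriv \<xi> t q v a - total_deriv \<tau> t q v a *\<^sub>R v)
        + L t q v * total_deriv \<tau> t q v a - total_deriv f t q v a
    = (grad_q L t q v - total_deriv (grad_v L) t q v a) \<bullet> (\<xi> t q v - \<tau> t q v *\<^sub>R v)
        - total_deriv (associated_integral L \<tau> \<xi> f) t q v a"
  by (simp add: total_deriv_associated_integral [OF assms]
      total_deriv_eq_gradients [OF class_C_differentiable [OF L]] algebra_simps)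

text \<open>Once the associated integral is \<open>N\<close>, both terms of the defect contain \<open>a\<close> only through
  \<open>a - \<Lambda>\<close>; the symmetry of the Hessian moves it off this vector, and the vector becomes a common factor.\<close>

lemma killing_defect_first_integral:
  fixes L N \<tau> f :: "real \<Rightarrow> real ^ 'n \<Rightarrow> real ^ 'n \<Rightarrow> real"
  assumes L: "class_C 3 (phase L)" and det: "\<And>t q v. det (hessian_v L t q v) \<noteq> 0"
    and N: "class_C (Suc m) (phase N)" "first_integral L N"
    and \<tau>: "class_C (Suc i) (phase \<tau>)" and \<xi>: "class_C (Suc j) (phase \<xi>)" and f: "class_C (Suc l) (phase f)"
    and assoc: "associated_integral L \<tau> \<xi> f = N"
  shows "\<tau> t q v * partial_t L t q v + grad_q L t q v \<bullet> \<xi> t q v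
        + grad_v L t q v \<bullet> (total_deriv \<xi> t q v a - total_deriv \<tau> t q v a *\<^sub>R v)
        + L t q v * total_deriv \<tau> t q v a - total_deriv f t q v a
    = - ((grad_v N t q v + hessian_v L t q v *v (\<xi> t q v - \<tau> t q v *\<^sub>R v))
          \<bullet> (a - acceleration L t q v))"
proof -
  have L3: "class_C (Suc (Suc (Suc 0))) (phase L)"
    using L by (simp only: numeral_3_eq_3)
  note dP = class_C_differentiable [OF class_C_grad_v [OF L3]] and dN = class_C_differentiable [OF N(1)]
  have "total_deriv N t q v a
      = total_deriv N t q v (acceleration L t q v) + grad_v N t q v \<bullet> (a - acceleration L t q v)"
    by (simp add: total_deriv_eq_gradients [OF dN] inner_diff_right)
  then have "total_deriv N t q v a = grad_v N t q v \<bullet> (a - acceleration L t q v)"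
    by (simp add: total_deriv_eq [OF dN] first_integral_imp_Df_eq_0 [OF L det N])
  moreover have "total_deriv (grad_v L) t q v a
      = grad_q L t q v + hessian_v L t q v *v (a - acceleration L t q v)"
    by (simp add: total_deriv_eq [OF dP] Df_grad_v [OF L det])
  moreover have "(hessian_v L t q v *v (a - acceleration L t q v)) \<bullet> (\<xi> t q v - \<tau> t q v *\<^sub>R v)
      = (hessian_v L t q v *v (\<xi> t q v - \<tau> t q v *\<^sub>R v)) \<bullet> (a - acceleration L t q v)"
    by (metis hessian_v_symmetric [OF L3] inner_commute)
  ultimately show ?thesis
    unfolding killing_defect [OF L3 \<tau> \<xi> f] assoc by (simp add: inner_add_left)
qed

theorem theorem2:
  fixes L N \<tau> f :: "real \<Rightarrow> real ^ 'n \<Rightarrow> real ^ 'n \<Rightarrow> real"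
    and \<xi> :: "real \<Rightarrow> real ^ 'n \<Rightarrow> real ^ 'n \<Rightarrow> real ^ 'n"
  assumes "class_C 3 (\<lambda>(t, q, v). L t q v)"
    and "\<And>t q v. det (hessian_v L t q v) \<noteq> 0"
    and "class_C 2 (\<lambda>(t, q, v). N t q v)"
    and "first_integral L N"
    and "class_C 1 (\<lambda>(t, q, v). \<tau> t q v)"
    and "class_C 1 (\<lambda>(t, q, v). \<xi> t q v)"
    and "class_C 1 (\<lambda>(t, q, v). f t q v)"
  shows "(strong_killing L \<tau> \<xi> f \<and>
          (\<forall>t q v. associated_integral L \<tau> \<xi> f t q v = N t q v))
     \<longleftrightarrow>
         (\<forall>t q v.
            \<xi> t q v = \<tau> t q v *\<^sub>R v - matrix_inv (hessian_v L t q v) *v grad_v N t q v \<and>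
            f t q v = \<tau> t q v * L t q v + N t q v
              - grad_v L t q v \<bullet> (matrix_inv (hessian_v L t q v) *v grad_v N t q v))"
    (is "?K \<and> ?A \<longleftrightarrow> (\<forall>t q v. ?\<xi> t q v \<and> ?f t q v)")
proof -
  define w where "w t q v = matrix_inv (hessian_v L t q v) *v grad_v N t q v" for t q v
  have \<xi>_iff: "?\<xi> t q v \<longleftrightarrow> grad_v N t q v + hessian_v L t q v *v (\<xi> t q v - \<tau> t q v *\<^sub>R v) = 0" for t q v
  proof -
    note inv = matrix_inv_cancel [OF assms(2)]
    have "?\<xi> t q v \<longleftrightarrow> \<xi> t q v - \<tau> t q v *\<^sub>R v = - w t q v"
      by (auto simp: w_def algebra_simps)
    also have "\<dots> \<longleftrightarrow> hessian_v L t q v *v (\<xi> t q v - \<tau> t q v *\<^sub>R v) = hessian_v L t q v *v (- w t q v)"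
      by (metis inv(2))
    also have "hessian_v L t q v *v (- w t q v) = - grad_v N t q v"
      by (simp add: w_def inv linear_neg [OF matrix_vector_mul_linear])
    finally show ?thesis
      by (simp add: add_eq_0_iff)
  qed
  have A_iff: "associated_integral L \<tau> \<xi> f t q v = N t q v \<longleftrightarrow> ?f t q v" if "?\<xi> t q v" for t q v
  proof -
    have "\<xi> t q v - \<tau> t q v *\<^sub>R v = - w t q v"
      using that by (simp add: w_def)
    then show ?thesis
      by (auto simp: associated_integral_def w_def mult.commute)
  qed
  have K_iff: "?K \<longleftrightarrow> (\<forall>t q v. ?\<xi> t q v)" if ?A
  proof -
    have "associated_integral L \<tau> \<xi> f = N"
      using that by (intro ext) simp
    note defect = killing_defect_first_integral [OF assms(1,2)
        assms(3) [unfolded numeral_2_eq_2] assms(4) assms(5-7) [unfolded One_nat_def] this]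
    have "?K \<longleftrightarrow> (\<forall>t q v a. (grad_v N t q v + hessian_v L t q v *v (\<xi> t q v - \<tau> t q v *\<^sub>R v))
          \<bullet> (a - acceleration L t q v) = 0)"
      unfolding strong_killing_def using defect by (metis (no_types, lifting) eq_iff_diff_eq_0 neg_equal_0_iff_equal)
    \<comment> \<open>The acceleration \<open>a\<close> is free, so \<open>a - acceleration L t q v\<close> is an arbitrary vector.\<close>
    also have "\<dots> \<longleftrightarrow> (\<forall>t q v. grad_v N t q v + hessian_v L t q v *v (\<xi> t q v - \<tau> t q v *\<^sub>R v) = 0)"
      by (metis add_diff_cancel_right' inner_eq_zero_iff inner_zero_left)
    finally show ?thesis by (simp only: \<xi>_iff)
  qed
  show ?thesis
  proof
    assume "?K \<and> ?A"
    with K_iff A_iff show "\<forall>t q v. ?\<xi> t q v \<and> ?f t q v" by blast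
  next
    assume "\<forall>t q v. ?\<xi> t q v \<and> ?f t q v"
    with K_iff A_iff show "?K \<and> ?A" by blast
  qed
qed

end
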